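(* Suppose $L$ is a regular trace class $L$-operator with parameter sequence $a=\{a_n\}_{n=0}^\infty$. Then $$\det(1-zL)=\lim_{n\to\infty}(-1)^n\left[\prod_{j=1}^{n-1}(a_{j-1}-a_j)\right]\left(a_{n-1}p_n(z)+a_nb_{n-1}p_{n-1}(z)\right)$$ for all $z\in\mathbb{C}$.
   Context: $\mathbb{N}_0=\{0,1,2,\dots\}$. An $L$-matrix with parameter sequence $a$ (a complex sequence) is the semi-infinite matrix $\mathcal{L}$ with $\mathcal{L}_{m,n}=a_{\max(m,n)}$, $m,n\in\mathbb{N}_0$. It is regular if $a_n\ne a_{n+1}$ for all $n\in\mathbb{N}_0$. For regular $\mathcal{L}$ put $b_n=\frac{1}{a_n-a_{n+1}}$ and let $\mathcal{J}$ be the tridiagonal matrix with $\mathcal{J}_{0,0}=b_0$, $\mathcal{J}_{n,n}=b_{n-1}+b_n$ for $n\ge1$, $\mathcal{J}_{n,n+1}=\mathcal{J}_{n+1,n}=-b_n$ for $n\ge0$, other entries $0$. Let $J$ be the operator on $\ell^2(\mathbb{N}_0)$ with $Jx=\mathcal{J}\cdot x$, $\mathrm{Dom}\,J=\{x\in\ell^2(\mathbb{N}_0):\mathcal{J}\cdot x\in\ell^2(\mathbb{N}_0)\}$; it is injective and coincides with the closure of its restriction to finitely supported sequences. The regular $L$-operator associated to $\mathcal{L}$ is $L:=J^{-1}$. $\det(1-zL)$ is the Fredholm determinant. The polynomials $p_n$ are $p_n(z)=\det(z-J_n)$, where $J_n$ is the upper left $n\times n$ section of $\mathcal{J}$; equivalently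 $p_0(z)=1$, $p_1(z)=z-b_0$, and $p_{n+1}(z)=(z-b_{n-1}-b_n)p_n(z)-b_{n-1}^2p_{n-1}(z)$ for $n\ge1$.
   Formalization: The formal theorem also assumes that the matrix of L = J^{-1} is the L-matrix of a (equivalently a_n → 0); J depends only on differences of a, and without this the formula fails, e.g. for a_n = 1 + 2^{-n}. *)

theory Defs
  imports "HOL-Analysis.Infinite_Sum" "Jordan_Normal_Form.Determinant"
begin

section \<open>The Hilbert space of square summable sequences and operators on it\<close>

definition ell2 :: "(nat \<Rightarrow> complex) set" where
  "ell2 = {x. summable (\<lambda>n. (cmod (x n))\<^sup>2)}"

text \<open>The inner product is linear in the first argument.\<close>

definition ell2_inner :: "(nat \<Rightarrow> complex) \<Rightarrow> (nat \<Rightarrow> complex) \<Rightarrow> complex" where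
  "ell2_inner x y = (\<Sum>n. x n * cnj (y n))"

definition ell2_norm :: "(nat \<Rightarrow> complex) \<Rightarrow> real" where
  "ell2_norm x = sqrt (\<Sum>n. (cmod (x n))\<^sup>2)"

definition basis_vec :: "nat \<Rightarrow> nat \<Rightarrow> complex" where
  "basis_vec m = (\<lambda>n. if n = m then 1 else 0)"

definition bounded_op :: "((nat \<Rightarrow> complex) \<Rightarrow> (nat \<Rightarrow> complex)) \<Rightarrow> bool" where
  "bounded_op T \<longleftrightarrow>
     (\<forall>x\<in>ell2. T x \<in> ell2) \<and>
     (\<forall>x\<in>ell2. \<forall>y\<in>ell2. T (\<lambda>n. x n + y n) = (\<lambda>n. T x n + T y n)) \<and>
     (\<forall>c. \<forall>x\<in>ell2. T (\<lambda>n. c * x n) = (\<lambda>n. c * T x n)) \<and>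
     (\<exists>C. \<forall>x\<in>ell2. ell2_norm (T x) \<le> C * ell2_norm x)"

definition positive_op :: "((nat \<Rightarrow> complex) \<Rightarrow> (nat \<Rightarrow> complex)) \<Rightarrow> bool" where
  "positive_op P \<longleftrightarrow> bounded_op P \<and>
     (\<forall>x\<in>ell2. Im (ell2_inner (P x) x) = 0 \<and> Re (ell2_inner (P x) x) \<ge> 0)"

text \<open>The last conjunct says $P^2 = T^* T$; hence $P$ is the absolute value
  $|T| = (T^* T)^{1/2}$, the unique positive square root.\<close>

definition is_abs_op ::
  "((nat \<Rightarrow> complex) \<Rightarrow> (nat \<Rightarrow> complex)) \<Rightarrow> ((nat \<Rightarrow> complex) \<Rightarrow> (nat \<Rightarrow> complex)) \<Rightarrow> bool" where
  "is_abs_op T P \<longleftrightarrow> positive_op P \<and>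
     (\<forall>x\<in>ell2. \<forall>y\<in>ell2. ell2_inner (P (P x)) y = ell2_inner (T x) (T y))"

text \<open>A possibly unbounded operator is a pair of its domain and its action; the values of
  the action outside the domain are irrelevant.\<close>

type_synonym ell2_operator =
  "(nat \<Rightarrow> complex) set \<times> ((nat \<Rightarrow> complex) \<Rightarrow> (nat \<Rightarrow> complex))"

definition op_inverse :: "ell2_operator \<Rightarrow> ell2_operator" where
  "op_inverse A = (snd A ` fst A, the_inv_into (fst A) (snd A))"

text \<open>Trace class means everywhere defined, bounded, and $\mathrm{Tr}\,|A| < \infty$.\<close>

definition trace_class :: "ell2_operator \<Rightarrow> bool" where
  "trace_class A \<longleftrightarrow> fst A = ell2 \<and> bounded_op (snd A) \<and>
     (\<exists>P. is_abs_op (snd A) P \<and>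
          summable (\<lambda>n. Re (ell2_inner (P (basis_vec n)) (basis_vec n))))"

definition op_scale :: "complex \<Rightarrow> ell2_operator \<Rightarrow> ell2_operator" where
  "op_scale c A = (fst A, \<lambda>x n. c * snd A x n)"

definition matrix_entry :: "ell2_operator \<Rightarrow> nat \<Rightarrow> nat \<Rightarrow> complex" where
  "matrix_entry A m n = ell2_inner (snd A (basis_vec n)) (basis_vec m)"

section \<open>Fredholm determinant\<close>

definition principal_minor :: "(nat \<Rightarrow> nat \<Rightarrow> complex) \<Rightarrow> nat set \<Rightarrow> complex" where
  "principal_minor M S =
     (let s = sorted_list_of_set S
      in det (mat (card S) (card S) (\<lambda>(i, j). M (s ! i) (s ! j))))"

text \<open>The trace of the $k$-th exterior power $\Lambda^k(A)$. The vectors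
  $e_S = e_{s_1} \wedge \dots \wedge e_{s_k}$, with $S = \{s_1 < \dots < s_k\}$, form an orthonormal
  basis of $\Lambda^k(\ell^2)$, and $\langle \Lambda^k(A) e_S, e_S \rangle$ is the determinant of
  $(\langle A e_j, e_i \rangle)_{i,j \in S}$.\<close>

definition trace_ext_power :: "nat \<Rightarrow> ell2_operator \<Rightarrow> complex" where
  "trace_ext_power k A =
     (\<Sum>\<^sub>\<infinity>S\<in>{S. finite S \<and> card S = k}. principal_minor (matrix_entry A) S)"

text \<open>This is $\det(1 + A) = \sum_k \mathrm{Tr}\,\Lambda^k(A)$ for trace class $A$.\<close>

definition fredholm_det_one_plus :: "ell2_operator \<Rightarrow> complex" where
  "fredholm_det_one_plus A = (\<Sum>k. trace_ext_power k A)"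

section \<open>L-matrices and L-operators\<close>

definition L_matrix :: "(nat \<Rightarrow> complex) \<Rightarrow> nat \<Rightarrow> nat \<Rightarrow> complex" where
  "L_matrix a m n = a (max m n)"

definition regular :: "(nat \<Rightarrow> complex) \<Rightarrow> bool" where
  "regular a \<longleftrightarrow> (\<forall>n. a n \<noteq> a (Suc n))"

definition b_seq :: "(nat \<Rightarrow> complex) \<Rightarrow> nat \<Rightarrow> complex" where
  "b_seq a n = 1 / (a n - a (Suc n))"

definition jacobi :: "(nat \<Rightarrow> complex) \<Rightarrow> nat \<Rightarrow> nat \<Rightarrow> complex" where
  "jacobi a m n =
     (if m = n then (if n = 0 then b_seq a 0 else b_seq a (n - 1) + b_seq a n)
      else if n = Suc m then - b_seq a m
      else if m = Suc n then - b_seq a n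
      else 0)"

definition mat_apply :: "(nat \<Rightarrow> nat \<Rightarrow> complex) \<Rightarrow> (nat \<Rightarrow> complex) \<Rightarrow> (nat \<Rightarrow> complex)" where
  "mat_apply M x = (\<lambda>m. \<Sum>n. M m n * x n)"

definition J_op :: "(nat \<Rightarrow> complex) \<Rightarrow> ell2_operator" where
  "J_op a = ({x \<in> ell2. mat_apply (jacobi a) x \<in> ell2}, mat_apply (jacobi a))"

definition L_op :: "(nat \<Rightarrow> complex) \<Rightarrow> ell2_operator" where
  "L_op a = op_inverse (J_op a)"

text \<open>An everywhere defined operator with \<open>matrix_entry A = L_matrix a\<close> is one whose matrix
  in the standard basis is the L-matrix with parameter sequence \<open>a\<close>. For \<open>L_op a\<close> this does not
  follow from \<open>trace_class (L_op a)\<close>: \<open>J_op a\<close>, hence \<open>L_op a\<close>, depends only on the differences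
  of \<open>a\<close>, so it is unchanged when a constant is added to \<open>a\<close>, while \<open>L_matrix a\<close> is not.\<close>

definition has_L_matrix :: "ell2_operator \<Rightarrow> (nat \<Rightarrow> complex) \<Rightarrow> bool" where
  "has_L_matrix A a \<longleftrightarrow> (\<forall>m n. matrix_entry A m n = L_matrix a m n)"

definition p_poly :: "(nat \<Rightarrow> complex) \<Rightarrow> nat \<Rightarrow> complex \<Rightarrow> complex" where
  "p_poly a n z = det (z \<cdot>\<^sub>m 1\<^sub>m n - mat n n (\<lambda>(i, j). jacobi a i j))"

section \<open>Injectivity of J\<close>

lemma mat_apply_jacobi_0:
  "mat_apply (jacobi a) x 0 = b_seq a 0 * (x 0 - x 1)"
proof -
  have "(\<Sum>n. jacobi a 0 n * x n) = (\<Sum>n\<in>{0, 1}. jacobi a 0 n * x n)"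
    by (rule suminf_finite) (auto simp: jacobi_def)
  then show ?thesis
    by (simp add: mat_apply_def jacobi_def algebra_simps)
qed

lemma mat_apply_jacobi_Suc:
  "mat_apply (jacobi a) x (Suc m) =
     b_seq a (Suc m) * (x (Suc m) - x (Suc (Suc m))) - b_seq a m * (x m - x (Suc m))"
proof -
  have "(\<Sum>n. jacobi a (Suc m) n * x n) =
      (\<Sum>n\<in>{m, Suc m, Suc (Suc m)}. jacobi a (Suc m) n * x n)"
    by (rule suminf_finite) (auto simp: jacobi_def)
  then show ?thesis
    by (simp add: mat_apply_def jacobi_def algebra_simps)
qed

text \<open>This makes the \<open>the_inv_into\<close> in \<open>L_op\<close> a genuine inverse.\<close>

lemma inj_on_J_op:
  assumes "regular a"
  shows "inj_on (snd (J_op a)) (fst (J_op a))"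
proof (rule inj_onI)
  fix x y
  assume x: "x \<in> fst (J_op a)" and y: "y \<in> fst (J_op a)"
    and eq: "snd (J_op a) x = snd (J_op a) y"
  have b: "b_seq a n \<noteq> 0" for n
    using assms by (simp add: b_seq_def regular_def)
  have eq': "mat_apply (jacobi a) x n = mat_apply (jacobi a) y n" for n
    using eq by (simp add: J_op_def)
  have "b_seq a n * (x n - x (Suc n)) = b_seq a n * (y n - y (Suc n))" for n
  proof (induction n)
    case 0
    show ?case using eq'[of 0] by (simp add: mat_apply_jacobi_0)
  next
    case (Suc n)
    then show ?case
      using eq'[of "Suc n"] unfolding mat_apply_jacobi_Suc by (metis diff_add_cancel)
  qed
  then have step: "x n - x (Suc n) = y n - y (Suc n)" for n
    using b[of n] by (metis mult_left_cancel)
  have const: "x n - y n = x 0 - y 0" for n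
  proof (induction n)
    case (Suc n)
    have "x (Suc n) - y (Suc n) = x n - y n"
      using step[of n] by (simp add: algebra_simps)
    with Suc show ?case by simp
  qed simp
  have tendsto_0: "u \<longlonglongrightarrow> 0" if "u \<in> fst (J_op a)" for u
  proof -
    have "(\<lambda>n. (cmod (u n))\<^sup>2) \<longlonglongrightarrow> 0"
      using that by (intro summable_LIMSEQ_zero) (simp add: J_op_def ell2_def)
    then have "(\<lambda>n. sqrt ((cmod (u n))\<^sup>2)) \<longlonglongrightarrow> sqrt 0"
      by (intro tendsto_real_sqrt)
    then show ?thesis by (simp add: tendsto_norm_zero_iff)
  qed
  have "(\<lambda>n. x n - y n) \<longlonglongrightarrow> 0 - 0"
    by (intro tendsto_diff tendsto_0 x y)
  moreover have "(\<lambda>n. x n - y n) = (\<lambda>n. x 0 - y 0)"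
    using const by (rule ext)
  ultimately have "(\<lambda>n::nat. x 0 - y 0) \<longlonglongrightarrow> 0"
    by simp
  then have "x 0 - y 0 = 0"
    using LIMSEQ_const_iff by blast
  then have "x n = y n" for n
    using const[of n] by simp
  then show "x = y"
    by (rule ext)
qed

end

theory Submission
  imports Defs "HOL-Analysis.Inner_Product"
begin

text \<open>The principal minor of the L-matrix on \<open>s\<^sub>1 < \<dots> < s\<^sub>k\<close> is
  \<open>a(s\<^sub>k) \<Prod> (a(s\<^sub>i) - a(s\<^sub>i\<^sub>+\<^sub>1))\<close>. Splitting the finite sets by their maximum turns the sum of the
  minors of \<open>- z L\<close> over all subsets of \<open>{..<n}\<close> into a recursion equivalent to the three-term
  recurrence of \<open>p\<^sub>n\<close>, so that this sum is exactly the \<open>n\<close>-th term of the sequence. The same recursion for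
  absolute values, with \<open>\<bar>a\<^sub>l - a\<^sub>m\<bar> \<le> \<bar>a\<^sub>l\<bar> + \<bar>a\<^sub>m\<bar>\<close>, bounds the sum of all \<open>\<bar>minors\<bar>\<close> as soon as
  \<open>\<Sum> \<bar>a\<^sub>n\<bar>\<close> and \<open>\<Sum> n \<bar>a\<^sub>n\<bar>\<^sup>2\<close> converge. These follow from \<open>\<bar>a\<^sub>n\<bar> \<le> \<langle>P e\<^sub>n, e\<^sub>n\<rangle>\<close> and
  \<open>n \<bar>a\<^sub>n\<bar>\<^sup>2 \<le> \<parallel>L e\<^sub>n\<parallel>\<^sup>2 = \<parallel>P e\<^sub>n\<parallel>\<^sup>2 \<le> \<parallel>P\<parallel> \<langle>P e\<^sub>n, e\<^sub>n\<rangle>\<close> with \<open>P = |L|\<close>; the first estimate uses that \<open>L\<close> is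
  complex symmetric, so \<open>L\<close> followed by complex conjugation is a symmetric real operator whose square
  is \<open>P\<^sup>2\<close>, and that \<open>e\<^sub>n\<close> lies in the range of \<open>L\<close>.\<close>

section \<open>Symmetric operators dominated by a positive square root\<close>

text \<open>Positivity of \<open>N\<close> along the line x + s N x gives a quadratic in s; a good
  choice of s turns it into the form inequality N^2 <= t N.\<close>

lemma positive_sq_norm_le:
  fixes N :: "'a::real_inner \<Rightarrow> 'a"
  assumes lin: "linear N"
    and sym: "\<And>x y. inner (N x) y = inner x (N y)"
    and pos: "\<And>x. inner (N x) x \<ge> 0"
    and bnd: "\<And>x. norm (N x) \<le> t * norm x"
  shows "(norm (N x))\<^sup>2 \<le> t * inner (N x) x"
proof (cases "N x = 0")
  case True
  then show ?thesis by simp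
next
  case False
  let ?u = "inner (N x) x" and ?v = "inner (N x) (N x)" and ?w = "inner (N (N x)) (N x)"
  have v: "?v > 0"
    using False by simp
  have "?w \<le> norm (N (N x)) * norm (N x)"
    by (rule norm_cauchy_schwarz)
  also have "\<dots> \<le> t * norm (N x) * norm (N x)"
    by (intro mult_right_mono bnd) auto
  finally have w: "?w \<le> t * ?v"
    by (simp add: power2_norm_eq_inner [symmetric] power2_eq_square)
  have "x \<noteq> 0"
    using False linear_0[OF lin] by auto
  moreover have "0 \<le> t * norm x"
    using bnd[of x] norm_ge_zero order_trans by blast
  ultimately have t: "t \<ge> 0"
    by (simp add: zero_le_mult_iff)
  have quad: "0 \<le> ?u + 2 * s * ?v + s\<^sup>2 * ?w" for s
  proof -
    have "0 \<le> inner (N (x + s *\<^sub>R N x)) (x + s *\<^sub>R N x)"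
      by (rule pos)
    also have "\<dots> = ?u + 2 * s * ?v + s\<^sup>2 * ?w"
      using sym[of "N x" x]
      by (simp add: linear_add[OF lin] linear_scale[OF lin] inner_simps power2_eq_square
          inner_commute algebra_simps)
    finally show ?thesis .
  qed
  have "t > 0"
    using False bnd[of x] t by (cases "t = 0") auto
  have "s\<^sup>2 * ?w \<le> s\<^sup>2 * (t * ?v)" for s
    by (intro mult_left_mono w) simp
  \<comment> \<open>This s minimises u + 2 s v + s^2 t v, the quadratic after w is replaced by its
    bound t v.\<close>
  with quad[of "- 1 / t"] have "0 \<le> ?u + 2 * (- 1 / t) * ?v + (- 1 / t)\<^sup>2 * (t * ?v)"
    by (smt (verit))
  also have "\<dots> = ?u - ?v / t"
    using \<open>t > 0\<close> by (simp add: field_simps power2_eq_square)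
  finally show ?thesis
    using \<open>t > 0\<close> by (simp add: field_simps power2_norm_eq_inner)
qed

text \<open>If \<open>N C = - C N\<close> then \<open>(t + N)\<^sup>n C = C (t - N)\<^sup>n\<close>. The right-hand side grows at most like \<open>t\<^sup>n\<close>,
  whereas \<open>\<parallel>(t + N)\<^sup>n w\<parallel>\<^sup>2\<close> is at least \<open>n t\<^sup>2\<^sup>n\<^sup>-\<^sup>2 \<parallel>N w\<parallel>\<^sup>2\<close>.\<close>

lemma positive_anticommute_zero:
  fixes N C :: "'a::real_inner \<Rightarrow> 'a"
  assumes linN: "linear N" and linC: "linear C"
    and sym: "\<And>x y. inner (N x) y = inner x (N y)"
    and pos: "\<And>x. inner (N x) x \<ge> 0"
    and bnd: "\<And>x. norm (N x) \<le> t * norm x" and t: "t > 0"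
    and bndC: "\<And>x. norm (C x) \<le> c * norm x"
    and anti: "\<And>x. N (C x) = - C (N x)"
  shows "N (C x) = 0"
proof -
  define A where "A = (\<lambda>u. t *\<^sub>R u + N u)"
  define B where "B = (\<lambda>u. t *\<^sub>R u - N u)"
  have NA: "N (A u) = A (N u)" for u
    by (simp add: A_def linear_add[OF linN] linear_scale[OF linN])
  have AC: "A (C u) = C (B u)" for u
    by (simp add: A_def B_def anti linear_diff[OF linC] linear_scale[OF linC])
  have ACn: "(A ^^ n) (C u) = C ((B ^^ n) u)" for n u
    by (induction n) (simp_all add: AC)
  have normA: "(norm (A u))\<^sup>2 \<ge> (t * norm u)\<^sup>2 + (norm (N u))\<^sup>2" for u
  proof -
    have "(norm (A u))\<^sup>2 = (t * norm u)\<^sup>2 + 2 * t * inner (N u) u + (norm (N u))\<^sup>2"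
      unfolding power2_norm_eq_inner A_def
      by (simp add: inner_simps power_mult_distrib power2_norm_eq_inner power2_eq_square[of t]
          inner_commute algebra_simps)
    then show ?thesis
      using pos[of u] t by simp
  qed
  have normB: "norm (B u) \<le> t * norm u" for u
  proof -
    have "(norm (B u))\<^sup>2 = (t * norm u)\<^sup>2 - 2 * t * inner (N u) u + (norm (N u))\<^sup>2"
      unfolding power2_norm_eq_inner B_def
      by (simp add: inner_simps power_mult_distrib power2_norm_eq_inner power2_eq_square[of t]
          inner_commute algebra_simps)
    \<comment> \<open>By N^2 <= t N the last term is absorbed by half of the cross term.\<close>
    also have "\<dots> \<le> (t * norm u)\<^sup>2"
      using positive_sq_norm_le[OF linN sym pos bnd, of u] mult_nonneg_nonneg[OF less_imp_le[OF t] pos[of u]]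
      by linarith
    finally show ?thesis
      using t by (simp add: power2_le_iff_abs_le)
  qed
  have normBn: "norm ((B ^^ n) u) \<le> t ^ n * norm u" for n u
  proof (induction n)
    case (Suc n)
    have "norm ((B ^^ Suc n) u) \<le> t * norm ((B ^^ n) u)"
      using normB by simp
    also have "\<dots> \<le> t * (t ^ n * norm u)"
      using Suc t by (intro mult_left_mono) auto
    finally show ?case by simp
  qed simp
  define w where "w = C x"
  \<comment> \<open>\<open>A\<close> commutes with \<open>N\<close> and expands every vector by at
    least t, so N A^n w = A^n (N w) grows at least like t^n.\<close>
  have normNAn: "(norm (N ((A ^^ n) w)))\<^sup>2 \<ge> t ^ (2 * n) * (norm (N w))\<^sup>2" for n
  proof (induction n)
    case (Suc n)
    have "t ^ (2 * Suc n) * (norm (N w))\<^sup>2 \<le> t\<^sup>2 * (norm (N ((A ^^ n) w)))\<^sup>2"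
      using mult_left_mono[OF Suc, of "t\<^sup>2"] by (simp add: power2_eq_square algebra_simps)
    also have "\<dots> \<le> (norm (A (N ((A ^^ n) w))))\<^sup>2"
      using normA[of "N ((A ^^ n) w)"]
      by (smt (verit) power_mult_distrib zero_le_power2)
    finally show ?case by (simp add: NA)
  qed simp
  \<comment> \<open>By \<open>normA\<close> each application of \<open>A\<close> adds |N A^n w|^2 to
    the squared norm, hence the factor n. The prefactor t^2 avoids the exponent 2 n - 2.\<close>
  have grow: "t\<^sup>2 * (norm ((A ^^ n) w))\<^sup>2 \<ge> t ^ (2 * n) * (real n * (norm (N w))\<^sup>2)" for n
  proof (induction n)
    case (Suc n)
    have "t ^ (2 * Suc n) * (real (Suc n) * (norm (N w))\<^sup>2)
        = t\<^sup>2 * (t ^ (2 * n) * (real n * (norm (N w))\<^sup>2)) + t\<^sup>2 * (t ^ (2 * n) * (norm (N w))\<^sup>2)"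
      by (simp add: power2_eq_square algebra_simps)
    also have "\<dots> \<le> t\<^sup>2 * (t\<^sup>2 * (norm ((A ^^ n) w))\<^sup>2) + t\<^sup>2 * (norm (N ((A ^^ n) w)))\<^sup>2"
      by (intro add_mono mult_left_mono Suc normNAn) auto
    also have "\<dots> = t\<^sup>2 * ((t * norm ((A ^^ n) w))\<^sup>2 + (norm (N ((A ^^ n) w)))\<^sup>2)"
      by (simp add: power_mult_distrib algebra_simps)
    also have "\<dots> \<le> t\<^sup>2 * (norm (A ((A ^^ n) w)))\<^sup>2"
      by (intro mult_left_mono normA) auto
    finally show ?case by simp
  qed simp
  have upper: "(norm ((A ^^ n) w))\<^sup>2 \<le> t ^ (2 * n) * (c * norm x)\<^sup>2" for n
  proof -
    have "norm ((A ^^ n) w) \<le> c * norm ((B ^^ n) x)"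
      by (simp add: w_def ACn bndC)
    also have "\<dots> \<le> \<bar>c\<bar> * (t ^ n * norm x)"
      by (intro mult_mono normBn) auto
    finally have "(norm ((A ^^ n) w))\<^sup>2 \<le> (\<bar>c\<bar> * (t ^ n * norm x))\<^sup>2"
      by (rule power_mono) simp
    then show ?thesis
      by (simp add: power_mult_distrib power_mult[symmetric] mult.commute mult.left_commute)
  qed
  \<comment> \<open>After cancelling t^(2n), growth linear in n faces a bound free of n.\<close>
  have "real n * (norm (N w))\<^sup>2 \<le> t\<^sup>2 * (c * norm x)\<^sup>2" for n
  proof -
    have "t ^ (2 * n) * (real n * (norm (N w))\<^sup>2) \<le> t\<^sup>2 * (t ^ (2 * n) * (c * norm x)\<^sup>2)"
      using grow[of n] mult_left_mono[OF upper[of n], of "t\<^sup>2"] by simp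
    then have "t ^ (2 * n) * (real n * (norm (N w))\<^sup>2) \<le> t ^ (2 * n) * (t\<^sup>2 * (c * norm x)\<^sup>2)"
      by (simp add: mult.left_commute)
    then show ?thesis
      using t by (simp only: mult_le_cancel_left_pos zero_less_power)
  qed
  then have "(norm (N w))\<^sup>2 \<le> 0"
    by (metis linorder_not_le reals_Archimedean3)
  then show ?thesis by (simp add: w_def)
qed

text \<open>The commutator \<open>C = N M - M N\<close> anticommutes with \<open>N\<close>, since \<open>N\<^sup>2 = M\<^sup>2\<close> commutes with \<open>M\<close>.\<close>

lemma positive_sqrt_commute:
  fixes M N :: "'a::real_inner \<Rightarrow> 'a"
  assumes linM: "linear M" and linN: "linear N"
    and symM: "\<And>x y. inner (M x) y = inner x (M y)"
    and symN: "\<And>x y. inner (N x) y = inner x (N y)"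
    and pos: "\<And>x. inner (N x) x \<ge> 0"
    and bnd: "\<And>x. norm (N x) \<le> t * norm x" and t: "t > 0"
    and sq: "\<And>x. M (M x) = N (N x)"
  shows "N (M x) = M (N x)"
proof -
  define C where "C = (\<lambda>u. N (M u) - M (N u))"
  have norm_eq: "norm (M u) = norm (N u)" for u
    by (simp add: norm_eq_sqrt_inner symM symN sq)
  have linC: "linear C"
    unfolding C_def by (intro linear_compose_sub linear_compose[unfolded o_def, OF linM linN]
        linear_compose[unfolded o_def, OF linN linM])
  have bndC: "norm (C u) \<le> (2 * t\<^sup>2) * norm u" for u
  proof -
    have "norm (C u) \<le> norm (N (M u)) + norm (M (N u))"
      unfolding C_def by (rule norm_triangle_ineq4)
    also have "\<dots> \<le> t * (t * norm u) + t * (t * norm u)"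
      using bnd[of u] t
      by (intro add_mono order_trans[OF bnd] mult_left_mono) (auto simp: norm_eq intro!: order_trans[OF bnd] mult_left_mono)
    finally show ?thesis by (simp add: power2_eq_square)
  qed
  have anti: "N (C u) = - C (N u)" for u
    by (simp add: C_def linear_diff[OF linN] linear_diff[OF linM] sq[symmetric])
  have NC: "N (C u) = 0" for u
    by (rule positive_anticommute_zero[where N = N and C = C and t = t and c = "2 * t\<^sup>2"])
      (fact linN linC symN pos bnd t bndC anti)+
  then have "M (C u) = 0" for u
    using norm_eq[of "C u"] by simp
  then have CC: "C (C u) = 0" for u
    using NC[of u] by (simp add: C_def[THEN fun_cong, of "C u"] linear_0[OF linM] linear_0[OF linN])
  \<comment> \<open>A commutator of symmetric operators is skew, so C^2 = 0 forces C = 0.\<close>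
  have "inner (C x) (C x) = - inner (C (C x)) x"
    by (simp add: C_def inner_simps symM symN)
  then show ?thesis
    by (simp add: CC) (simp add: C_def)
qed

text \<open>Write x = M y and test positivity of \<open>N\<close> on M y - N y. Commutation and M^2
  = N^2 turn both square terms into <N x, x> and the cross term into <M x, x>.\<close>

lemma le_positive_sqrt_on_range:
  fixes M N :: "'a::real_inner \<Rightarrow> 'a"
  assumes linM: "linear M" and linN: "linear N"
    and symM: "\<And>x y. inner (M x) y = inner x (M y)"
    and symN: "\<And>x y. inner (N x) y = inner x (N y)"
    and pos: "\<And>x. inner (N x) x \<ge> 0"
    and bnd: "\<And>x. norm (N x) \<le> t * norm x" and t: "t > 0"
    and sq: "\<And>x. M (M x) = N (N x)"
    and x: "x \<in> range M"
  shows "inner (M x) x \<le> inner (N x) x"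
proof -
  note comm = positive_sqrt_commute[OF linM linN symM symN pos bnd t sq]
  obtain y where y: "x = M y"
    using x by auto
  have eq: "inner (N (N y)) (N y) = inner (N x) x"
    unfolding sq[symmetric] symM[of "M y" "N y"] by (simp add: y comm inner_commute)
  have "0 \<le> inner (N (M y - N y)) (M y - N y)"
    by (rule pos)
  also have "\<dots> = inner (N x) x + inner (N (N y)) (N y) - 2 * inner (N (M y)) (N y)"
    unfolding y
    using symN[of "N y" "M y"]
    by (simp add: linear_diff[OF linN] inner_simps inner_commute)
  also have "inner (N (M y)) (N y) = inner (M x) x"
    using symN[of "N y" "M y"] by (simp add: y sq inner_commute)
  finally show ?thesis
    by (simp add: eq)
qed

section \<open>Sums over finite sets of natural numbers\<close>

lemma sum_Pow_lessThan:
  fixes f :: "nat set \<Rightarrow> 'a::comm_monoid_add"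
  shows "sum f (Pow {..<n}) = f {} + (\<Sum>m<n. \<Sum>S\<in>Pow {..<m}. f (insert m S))"
proof (induction n)
  case (Suc n)
  have inj: "inj_on (insert n) (Pow {..<n})"
    by (rule inj_onI) (metis Pow_iff insert_ident lessThan_iff less_irrefl subsetD)
  have "sum f (Pow {..<Suc n}) = sum f (Pow {..<n}) + sum f (insert n ` Pow {..<n})"
    unfolding lessThan_Suc Pow_insert
    by (rule sum.union_disjoint) auto
  also have "sum f (insert n ` Pow {..<n}) = (\<Sum>S\<in>Pow {..<n}. f (insert n S))"
    by (simp add: sum.reindex[OF inj])
  finally show ?case
    using Suc by (simp add: add.assoc)
qed simp

text \<open>Truncated subtraction makes the product 1 on the empty list as well as on
  singletons.\<close>

definition chain_prod :: "(nat \<Rightarrow> nat \<Rightarrow> 'a) \<Rightarrow> nat list \<Rightarrow> 'a::comm_monoid_mult" where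
  "chain_prod u xs = (\<Prod>i<length xs - 1. u (xs ! i) (xs ! Suc i))"

lemma chain_prod_snoc:
  "chain_prod u (xs @ [y, z]) = chain_prod u (xs @ [y]) * u y z"
proof -
  have "(xs @ [y, z]) ! Suc i = (xs @ [y]) ! Suc i" if "i < length xs" for i
    using that by (cases "Suc i = length xs") (simp_all add: nth_append)
  then show ?thesis
    by (simp add: chain_prod_def nth_append_left nth_append_right)
qed

lemma sorted_list_of_set_insert_greatest:
  assumes "S \<subseteq> {..<m::nat}"
  shows "sorted_list_of_set (insert m S) = sorted_list_of_set S @ [m]"
proof -
  have fin: "finite S" using assms finite_subset by blast
  moreover have "m \<notin> S" using assms by auto
  moreover have "\<forall>x\<in>set (sorted_list_of_set S). x \<le> m" using assms fin by auto
  ultimately show ?thesis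
    by (simp add: sorted_insort_is_snoc)
qed

text \<open>With t = - z and u l m = a l - a m this collects all minors with largest index m, up to
  the factor a m. The real instance with absolute values gives the majorant.\<close>

definition chain_sum :: "(nat \<Rightarrow> nat \<Rightarrow> 'a::comm_semiring_1) \<Rightarrow> 'a \<Rightarrow> nat \<Rightarrow> 'a" where
  "chain_sum u t m =
     (\<Sum>S\<in>Pow {..<m}. t ^ Suc (card S) * chain_prod u (sorted_list_of_set S @ [m]))"

text \<open>Sort by the largest element l of S, the predecessor of m in the chain; empty S gives the
  1.\<close>

lemma chain_sum_rec:
  "chain_sum u t m = t * (1 + (\<Sum>l<m. chain_sum u t l * u l m))"
proof -
  have card: "card (insert l S) = Suc (card S)" if "S \<subseteq> {..<l}" for l :: nat and S
    using that finite_subset[OF that finite_lessThan] by (subst card_insert_disjoint) auto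
  have "(\<Sum>S\<in>Pow {..<l}. t ^ Suc (card (insert l S)) *
           chain_prod u (sorted_list_of_set (insert l S) @ [m]))
      = t * (chain_sum u t l * u l m)" for l
    unfolding chain_sum_def sum_distrib_right sum_distrib_left
    by (intro sum.cong refl)
      (simp add: card sorted_list_of_set_insert_greatest chain_prod_snoc mult_ac)
  then show ?thesis
    unfolding chain_sum_def[of u t m]
    by (subst sum_Pow_lessThan) (simp add: chain_prod_def sum_distrib_left distrib_left)
qed

text \<open>The weight f stays abstract so that the lemma serves both the minors and their
  norms.\<close>

lemma sum_Pow_chain:
  fixes u :: "nat \<Rightarrow> nat \<Rightarrow> 'a::comm_semiring_1"
  assumes "f {} = 1"
    and "\<And>m S. S \<subseteq> {..<m} \<Longrightarrow>
      f (insert m S) = v m * (t ^ Suc (card S) * chain_prod u (sorted_list_of_set S @ [m]))"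
  shows "sum f (Pow {..<n}) = 1 + (\<Sum>m<n. chain_sum u t m * v m)"
  unfolding chain_sum_def
  by (subst sum_Pow_lessThan) (simp add: assms sum_distrib_left mult.commute)

text \<open>A discrete Gronwall argument: u l m <= d l + d m splits the recursion for g into X m and
  a cross term d m * K m, where \<open>K\<close> sums the g l without weights.\<close>

lemma chain_sum_bound:
  fixes d :: "nat \<Rightarrow> real"
  assumes t: "t \<ge> 0" and d: "\<And>n. d n \<ge> 0"
    and sum1: "summable d" and sum2: "summable (\<lambda>n. real n * (d n)\<^sup>2)"
    and u: "\<And>l m. 0 \<le> u l m \<and> u l m \<le> d l + d m"
  shows "\<exists>B. \<forall>n. 1 + (\<Sum>m<n. chain_sum u t m * d m) \<le> B"
proof -
  define g where "g = chain_sum u t"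
  \<comment> \<open>The relative increment of the majorant \<open>E\<close>: t d l comes from X, and
    t^2 l (d l)^2 from the cross term, since \<open>K\<close> may grow linearly.\<close>
  define e where "e = (\<lambda>l. t * d l + t\<^sup>2 * (real l * (d l)\<^sup>2))"
  define E where "E = (\<lambda>m. \<Prod>l<m. 1 + e l)"
  have e0: "e l \<ge> 0" for l
    unfolding e_def using t d by (intro add_nonneg_nonneg mult_nonneg_nonneg) auto
  have E0: "E m \<ge> 0" for m
    unfolding E_def using e0 by (intro prod_nonneg) (auto simp: add_nonneg_nonneg)
  have g0: "g m \<ge> 0" for m
    unfolding g_def chain_sum_def chain_prod_def using t u
    by (intro sum_nonneg mult_nonneg_nonneg prod_nonneg) auto
  define X where "X = (\<lambda>m. 1 + (\<Sum>l<m. g l * d l))"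
  define K where "K = (\<lambda>m. \<Sum>l<m. g l)"
  have g_le: "g m \<le> t * (X m + d m * K m)" for m
  proof -
    have "(\<Sum>l<m. g l * u l m) \<le> (\<Sum>l<m. g l * (d l + d m))"
      using u g0 by (intro sum_mono mult_left_mono) auto
    also have "\<dots> = (\<Sum>l<m. g l * d l) + d m * K m"
      by (simp add: K_def distrib_left sum.distrib sum_distrib_left mult.commute)
    finally have "1 + (\<Sum>l<m. g l * u l m) \<le> X m + d m * K m"
      by (simp add: X_def)
    then show ?thesis
      unfolding g_def chain_sum_rec[of u t m] using t
      by (intro mult_left_mono)
  qed
  \<comment> \<open>The two bounds need a joint induction, because \<open>g_le\<close> involves both
    X m and K m.\<close>
  have main: "X m \<le> E m \<and> K m \<le> t * real m * E m" for m
  proof (induction m)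
    case 0
    show ?case by (simp add: X_def K_def E_def)
  next
    case (Suc m)
    have "d m * K m \<le> d m * (t * real m * E m)"
      using Suc d by (intro mult_left_mono) auto
    with Suc have "t * (X m + d m * K m) \<le> t * (E m + d m * (t * real m * E m))"
      using t d by (intro mult_left_mono add_mono) auto
    with g_le[of m] have gE: "g m \<le> t * E m + t\<^sup>2 * real m * d m * E m"
      by (simp add: power2_eq_square algebra_simps)
    have "X (Suc m) = X m + d m * g m"
      by (simp add: X_def)
    also have "\<dots> \<le> E m + d m * (t * E m + t\<^sup>2 * real m * d m * E m)"
      using Suc gE d by (intro add_mono mult_left_mono) auto
    also have "\<dots> = E (Suc m)"
      by (simp add: E_def e_def power2_eq_square algebra_simps)
    finally have 1: "X (Suc m) \<le> E (Suc m)" .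
    have "K (Suc m) = K m + g m"
      by (simp add: K_def)
    also have "\<dots> \<le> t * real m * E m + (t * E m + t\<^sup>2 * real m * d m * E m)"
      using Suc gE by (intro add_mono) auto
    also have "\<dots> = t * (real (Suc m) * E m + E m * (real m * (t * d m)))"
      by (simp add: power2_eq_square algebra_simps)
    also have "\<dots> \<le> t * (real (Suc m) * E m + E m * (real (Suc m) * e m))"
      using t d E0 by (intro mult_left_mono add_left_mono mult_mono) (auto simp: e_def)
    also have "\<dots> = t * real (Suc m) * E (Suc m)"
      by (simp add: E_def algebra_simps)
    finally show ?case using 1 by blast
  qed
  have sume: "summable e"
    unfolding e_def by (intro summable_add summable_mult sum1 sum2)
  have "X n \<le> exp (suminf e)" for n
  proof -
    have "X n \<le> E n" using main by blast
    also have "E n \<le> (\<Prod>l<n. exp (e l))"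
      unfolding E_def using e0 exp_ge_add_one_self by (intro prod_mono) (auto simp: add_nonneg_nonneg)
    also have "\<dots> = exp (\<Sum>l<n. e l)"
      by (simp add: exp_sum)
    also have "\<dots> \<le> exp (suminf e)"
      using e0 by (simp add: sum_le_suminf[OF sume])
    finally show ?thesis .
  qed
  then show ?thesis
    by (auto simp: X_def g_def)
qed

text \<open>The limit along the increasing finite sets \<open>Pow {..<n}\<close> and the summation by
  cardinality both compute the unconditional sum over all finite sets.\<close>

lemma sum_Pow_tendsto_sum_by_card:
  fixes w :: "nat set \<Rightarrow> complex"
  assumes bnd: "\<And>n. (\<Sum>S\<in>Pow {..<n}. norm (w S)) \<le> B"
  shows "(\<lambda>n. \<Sum>S\<in>Pow {..<n}. w S) \<longlonglongrightarrow> (\<Sum>k. infsum w {S. finite S \<and> card S = k})"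
proof -
  let ?A = "{S::nat set. finite S}"
  have cover: "\<forall>\<^sub>F n in sequentially. F \<subseteq> Pow {..<n}" if F: "finite F" "F \<subseteq> ?A" for F
  proof -
    have "finite (\<Union>F)" using F by auto
    then obtain n where "\<Union>F \<subseteq> {..<n}"
      using finite_nat_iff_bounded by blast
    then have "F \<subseteq> Pow {..<k}" if "k \<ge> n" for k
      using that by (fastforce simp: subset_eq)
    then show ?thesis
      unfolding eventually_sequentially by blast
  qed
  have "(\<lambda>S. norm (w S)) summable_on ?A"
  proof (rule nonneg_bdd_above_summable_on)
    show "bdd_above (sum (\<lambda>S. norm (w S)) ` {F. F \<subseteq> ?A \<and> finite F})"
    proof (rule bdd_aboveI2)
      fix F assume "F \<in> {F. F \<subseteq> ?A \<and> finite F}"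
      then obtain n where "F \<subseteq> Pow {..<n}"
        using eventually_happens'[OF sequentially_bot cover[of F]] by blast
      then have "sum (\<lambda>S. norm (w S)) F \<le> (\<Sum>S\<in>Pow {..<n}. norm (w S))"
        by (intro sum_mono2) auto
      then show "sum (\<lambda>S. norm (w S)) F \<le> B"
        using bnd order_trans by blast
    qed
  qed auto
  then have summ: "w summable_on ?A"
    by (rule abs_summable_summable)
  then have tends: "(sum w \<longlongrightarrow> infsum w ?A) (finite_subsets_at_top ?A)"
    unfolding has_sum_def [symmetric] by (rule has_sum_infsum)
  \<comment> \<open>The sets Pow {..<n} are cofinal among the finite subsets of \<open>?A\<close>,
    so the net defining the sum may be read along them.\<close>
  have "filterlim (\<lambda>n. Pow {..<n::nat}) (finite_subsets_at_top ?A) sequentially"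
    unfolding filterlim_finite_subsets_at_top
  proof (intro allI impI)
    fix X assume "finite X \<and> X \<subseteq> ?A"
    then have "\<forall>\<^sub>F n in sequentially. X \<subseteq> Pow {..<n}"
      using cover by blast
    then show "\<forall>\<^sub>F n in sequentially. finite (Pow {..<n}) \<and> X \<subseteq> Pow {..<n} \<and> Pow {..<n} \<subseteq> ?A"
    proof eventually_elim
      case (elim n)
      have "Pow {..<n} \<subseteq> ?A"
        using finite_subset[OF _ finite_lessThan] by blast
      then show ?case
        using elim by simp
    qed
  qed
  from filterlim_compose[OF tends this]
  have lim: "(\<lambda>n. \<Sum>S\<in>Pow {..<n}. w S) \<longlonglongrightarrow> infsum w ?A" .
  let ?C = "\<lambda>k. {S::nat set. finite S \<and> card S = k}"
  have img: "snd ` Sigma UNIV ?C = ?A" by force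
  have inj: "inj_on snd (Sigma UNIV ?C)" by (auto simp: inj_on_def)
  have "((\<lambda>p. w (snd p)) has_sum infsum w ?A) (Sigma UNIV ?C)"
    using has_sum_infsum[OF summ] unfolding img[symmetric] has_sum_reindex[OF inj] o_def .
  moreover have "((\<lambda>S. w (snd (k, S))) has_sum infsum w (?C k)) (?C k)" for k
    using summable_on_subset_banach[OF summ, of "?C k"] by (auto intro: has_sum_infsum)
  ultimately have "((\<lambda>k. infsum w (?C k)) has_sum infsum w ?A) UNIV"
    by (rule has_sum_Sigma'[where A = UNIV and B = ?C]) 
  from has_sum_imp_sums[OF this] show ?thesis
    using lim by (simp add: sums_unique[symmetric])
qed

section \<open>Minors of the L-matrix and characteristic polynomials of Jacobi sections\<close>

text \<open>Subtracting the second row from the first leaves only the corner entry c (a x - a y),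
  because \<open>max x\<close> and \<open>max y\<close> agree on all later entries. Laplace
  expansion then removes the first index.\<close>

lemma det_max_matrix:
  fixes a :: "nat \<Rightarrow> complex"
  assumes "sorted xs" and "xs \<noteq> []"
  shows "det (mat (length xs) (length xs) (\<lambda>(i, j). c * a (max (xs ! i) (xs ! j))))
    = c ^ length xs * chain_prod (\<lambda>l m. a l - a m) xs * a (last xs)"
  using assms
proof (induction xs rule: induct_list012)
  case (2 x)
  show ?case
    by (subst det_single) (auto simp: chain_prod_def)
next
  case (3 x y ys)
  let ?A = "\<lambda>xs. mat (length xs) (length xs) (\<lambda>(i, j). c * a (max (xs ! i) (xs ! j)))"
  let ?n = "length (x # y # ys)"
  define R where "R = addrow (-1) 0 1 (?A (x # y # ys))"
  have R: "R \<in> carrier_mat ?n ?n"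
    by (simp add: R_def)
  have max: "max x ((x # y # ys) ! j) = max y ((x # y # ys) ! j)" if "0 < j" "j < ?n" for j
  proof -
    from that have "(x # y # ys) ! j \<in> set (y # ys)"
      by (metis Suc_less_eq Suc_pred length_Cons nth_Cons_pos nth_mem diff_Suc_1 One_nat_def)
    then show ?thesis
      using 3(3) by (auto simp: max_def)
  qed
  have row0: "R $$ (0, j) = (if j = 0 then c * (a x - a y) else 0)" if "j < ?n" for j
    using that max[of j] 3(3)
    by (cases "j = 0") (simp_all add: R_def max.commute max.absorb1 max.absorb2 algebra_simps)
  have del: "mat_delete R 0 0 = ?A (y # ys)"
    by (rule eq_matI) (auto simp: mat_delete_def R_def)
  have "det (?A (x # y # ys)) = det R"
    unfolding R_def by (rule det_addrow[where n = ?n, symmetric]) auto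
  also have "\<dots> = (\<Sum>j<?n. R $$ (0, j) * cofactor R 0 j)"
    by (rule laplace_expansion_row[OF R]) simp
  also have "\<dots> = (\<Sum>j\<in>{0}. R $$ (0, j) * cofactor R 0 j)"
    by (rule sum.mono_neutral_right) (auto simp: row0)
  also have "\<dots> = c * (a x - a y) * det (?A (y # ys))"
    using row0[of 0] by (simp add: cofactor_def del)
  also have "det (?A (y # ys))
      = c ^ length (y # ys) * chain_prod (\<lambda>l m. a l - a m) (y # ys) * a (last (y # ys))"
    by (rule 3(2)) (use 3(3) in auto)
  also have "chain_prod (\<lambda>l m. a l - a m) (x # y # ys)
      = (a x - a y) * chain_prod (\<lambda>l m. a l - a m) (y # ys)"
    by (simp add: chain_prod_def prod.lessThan_Suc_shift del: prod.lessThan_Suc)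
  then have "c * (a x - a y) * (c ^ length (y # ys) * chain_prod (\<lambda>l m. a l - a m) (y # ys) * a (last (y # ys)))
      = c ^ ?n * chain_prod (\<lambda>l m. a l - a m) (x # y # ys) * a (last (x # y # ys))"
    by simp
  finally show ?case .
qed simp

lemma principal_minor_empty: "principal_minor M {} = 1"
  by (simp add: principal_minor_def)

lemma principal_minor_max_matrix:
  assumes "S \<subseteq> {..<m}" and M: "\<And>i j. M i j = c * a (max i j)"
  shows "principal_minor M (insert m S) =
    a m * (c ^ Suc (card S) * chain_prod (\<lambda>l m. a l - a m) (sorted_list_of_set S @ [m]))"
proof -
  have fin: "finite S" "m \<notin> S"
    using assms(1) finite_subset by auto
  let ?s = "sorted_list_of_set (insert m S)"
  have s: "?s = sorted_list_of_set S @ [m]"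
    by (rule sorted_list_of_set_insert_greatest[OF assms(1)])
  have "principal_minor M (insert m S)
      = det (mat (length ?s) (length ?s) (\<lambda>(i, j). c * a (max (?s ! i) (?s ! j))))"
    unfolding principal_minor_def Let_def using fin by (simp add: M)
  also have "\<dots> = c ^ length ?s * chain_prod (\<lambda>l m. a l - a m) ?s * a (last ?s)"
    by (rule det_max_matrix, rule sorted_sorted_list_of_set) (simp add: s)
  finally show ?thesis
    using fin by (simp add: s)
qed

section \<open>Characteristic polynomials of the Jacobi sections\<close>

lemma p_poly_0: "p_poly a 0 z = 1"
  unfolding p_poly_def by (rule det_dim_zero) auto

lemma p_poly_1: "p_poly a (Suc 0) z = z - b_seq a 0"
  unfolding p_poly_def by (subst det_single) (auto simp: jacobi_def)

text \<open>Laplace expansion along the last row, where only the last two columns contribute, then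
  along the last column of the minor \<open>?B\<close>.\<close>

lemma p_poly_rec:
  "p_poly a (Suc (Suc n)) z =
     (z - b_seq a n - b_seq a (Suc n)) * p_poly a (Suc n) z - (b_seq a n)\<^sup>2 * p_poly a n z"
proof -
  let ?A = "\<lambda>n. z \<cdot>\<^sub>m 1\<^sub>m n - mat n n (\<lambda>(i, j). jacobi a i j)"
  let ?N = "Suc (Suc n)"
  have jac: "jacobi a (Suc n) n = - b_seq a n"
      "jacobi a (Suc n) (Suc n) = b_seq a n + b_seq a (Suc n)"
    by (simp_all add: jacobi_def)
  have A: "?A k \<in> carrier_mat k k" for k by auto
  let ?B = "mat_delete (?A ?N) (Suc n) n"
  have B: "?B \<in> carrier_mat (Suc n) (Suc n)"
    using mat_delete_carrier[OF A[of ?N]] by simp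
  have del1: "mat_delete (?A ?N) (Suc n) (Suc n) = ?A (Suc n)"
    by (rule eq_matI) (auto simp: mat_delete_def)
  have del2: "mat_delete ?B n n = ?A n"
    by (rule eq_matI) (auto simp: mat_delete_def)
  have "det ?B = (\<Sum>i<Suc n. ?B $$ (i, n) * cofactor ?B i n)"
    by (rule laplace_expansion_column[OF B]) simp
  also have "\<dots> = (\<Sum>i\<in>{n}. ?B $$ (i, n) * cofactor ?B i n)"
    by (rule sum.mono_neutral_right) (auto simp: mat_delete_def jacobi_def)
  also have "\<dots> = b_seq a n * p_poly a n z"
    by (simp add: cofactor_def del2 p_poly_def) (simp add: mat_delete_def jacobi_def)
  finally have detB: "det ?B = b_seq a n * p_poly a n z" .
  have "det (?A ?N) = (\<Sum>j<?N. ?A ?N $$ (Suc n, j) * cofactor (?A ?N) (Suc n) j)"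
    by (rule laplace_expansion_row[OF A]) simp
  also have "\<dots> = (\<Sum>j\<in>{n, Suc n}. ?A ?N $$ (Suc n, j) * cofactor (?A ?N) (Suc n) j)"
    by (rule sum.mono_neutral_right) (auto simp: jacobi_def)
  \<comment> \<open>The entry left of the diagonal is + b_n in z - J, and its cofactor carries the
    sign -1.\<close>
  also have "\<dots> = b_seq a n * (- det ?B) + (z - b_seq a n - b_seq a (Suc n)) * p_poly a (Suc n) z"
    by (simp add: cofactor_def del1 p_poly_def jac)
  finally show ?thesis
    unfolding detB by (simp add: p_poly_def power2_eq_square)
qed

text \<open>Call the left side Q n. Its differences times b_n are partial sums of the chain sums - z
  Q l, so Q formally solves J Q = z Q with Q 0 = 1; this is the recurrence of p_n up to
  normalisation.\<close>

lemma chain_sum_eq_p_poly: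
  fixes a :: "nat \<Rightarrow> complex"
  assumes "regular a"
  shows "1 + (\<Sum>l<n. chain_sum (\<lambda>l m. a l - a m) (- z) l * (a l - a n))
    = (- 1) ^ n * (\<Prod>j<n. a j - a (Suc j)) * p_poly a n z"
proof -
  define G where "G = chain_sum (\<lambda>l m. a l - a m) (- z)"
  define Q where "Q = (\<lambda>n. 1 + (\<Sum>l<n. G l * (a l - a n)))"
  define c where "c = (\<lambda>n. a n - a (Suc n))"
  have c0: "c n \<noteq> 0" for n
    using assms by (simp add: regular_def c_def)
  have b: "b_seq a n = 1 / c n" for n
    by (simp add: b_seq_def c_def)
  have G: "G n = - z * Q n" for n
    unfolding G_def Q_def by (rule chain_sum_rec)
  \<comment> \<open>Passing from a n to a (n + 1) shifts every weight by c n; the new term l = n has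
    weight c n itself.\<close>
  have step: "Q (Suc n) = Q n + c n * (\<Sum>l<Suc n. G l)" for n
    by (simp add: Q_def c_def algebra_simps sum.distrib sum_subtractf sum_distrib_left)
  have "Q n = (- 1) ^ n * (\<Prod>j<n. c j) * p_poly a n z"
  proof (induction n rule: induct_nat_012)
    case 0
    show ?case by (simp add: Q_def p_poly_0)
  next
    case 1
    show ?case
      using c0[of 0] by (simp add: step G p_poly_1 b) (simp add: Q_def field_simps)
  next
    case (ge2 n)
    define P where "P = (- 1) ^ n * (\<Prod>j<n. c j)"
    have Q0: "Q n = P * p_poly a n z" and Q1: "Q (Suc n) = - P * c n * p_poly a (Suc n) z"
      using ge2 by (simp_all add: P_def)
    have "c n * (\<Sum>l<Suc n. G l) = Q (Suc n) - Q n"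
      by (simp add: step del: sum.lessThan_Suc)
    then have "(\<Sum>l<Suc n. G l) = (Q (Suc n) - Q n) / c n"
      using c0[of n] by (simp add: field_simps del: sum.lessThan_Suc)
    then have "Q (Suc (Suc n)) = Q (Suc n) + c (Suc n) * ((Q (Suc n) - Q n) / c n - z * Q (Suc n))"
      by (simp add: step[of "Suc n"] G[of "Suc n"])
    also have "\<dots> = P * c n * c (Suc n) * p_poly a (Suc (Suc n)) z"
      using c0[of n] c0[of "Suc n"] unfolding Q0 Q1 p_poly_rec b
      by (simp add: field_simps power2_eq_square)
    finally show ?case
      by (simp add: P_def mult_ac)
  qed
  then show ?thesis
    by (simp add: Q_def G_def c_def)
qed

text \<open>The weights a l come from two consecutive Q through a m (a l - a (m + 1)) - a (m + 1) (a
  l - a m) = (a m - a (m + 1)) a l; the term l = m missing from Q m has weight 0.\<close>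

lemma finite_section_formula:
  fixes a :: "nat \<Rightarrow> complex"
  assumes "regular a"
  shows "(- 1) ^ Suc m * (\<Prod>j=1..m. a (j - 1) - a j) *
      (a m * p_poly a (Suc m) z + a (Suc m) * b_seq a m * p_poly a m z)
    = 1 + (\<Sum>l<Suc m. chain_sum (\<lambda>l m. a l - a m) (- z) l * a l)"
proof -
  define G where "G = chain_sum (\<lambda>l m. a l - a m) (- z)"
  define Q where "Q = (\<lambda>n. 1 + (\<Sum>l<n. G l * (a l - a n)))"
  define d where "d = a m - a (Suc m)"
  define P where "P = (- 1) ^ m * (\<Prod>j<m. a j - a (Suc j))"
  have d0: "d \<noteq> 0"
    using assms by (simp add: regular_def d_def)
  have Q0: "Q m = P * p_poly a m z"
    using chain_sum_eq_p_poly[OF assms, where n = m and z = z] by (simp add: Q_def G_def P_def)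
  have Q1: "Q (Suc m) = - P * d * p_poly a (Suc m) z"
    using chain_sum_eq_p_poly[OF assms, where n = "Suc m" and z = z]
    by (simp add: Q_def G_def P_def d_def mult_ac)
  have prod: "(\<Prod>j=1..m. a (j - 1) - a j) = (\<Prod>j<m. a j - a (Suc j))"
    by (rule prod.reindex_bij_witness[of _ Suc "\<lambda>j. j - 1"]) auto
  have "(- 1) ^ Suc m * (\<Prod>j=1..m. a (j - 1) - a j) *
      (a m * p_poly a (Suc m) z + a (Suc m) * b_seq a m * p_poly a m z)
    = (a m * Q (Suc m) - a (Suc m) * Q m) / d"
    using d0 unfolding prod Q0 Q1 b_seq_def d_def[symmetric]
    by (simp add: P_def field_simps)
  also have "a m * Q (Suc m) - a (Suc m) * Q m = d * (1 + (\<Sum>l<Suc m. G l * a l))"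
    by (simp add: Q_def d_def algebra_simps sum.distrib sum_subtractf sum_distrib_left)
  finally show ?thesis
    using d0 by (simp add: G_def)
qed

section \<open>Square summable sequences as a real inner product space\<close>

lemma ell2_add:
  assumes "x \<in> ell2" "y \<in> ell2"
  shows "(\<lambda>n. x n + y n) \<in> ell2"
proof -
  have sm: "summable (\<lambda>n. 2 * (cmod (x n))\<^sup>2 + 2 * (cmod (y n))\<^sup>2)"
    using assms by (intro summable_add summable_mult) (auto simp: ell2_def)
  have le: "(cmod (u + v))\<^sup>2 \<le> 2 * (cmod u)\<^sup>2 + 2 * (cmod v)\<^sup>2" for u v
  proof -
    have "(cmod (u + v))\<^sup>2 \<le> (cmod u + cmod v)\<^sup>2"
      by (intro power_mono norm_triangle_ineq) auto
    also have "\<dots> \<le> 2 * (cmod u)\<^sup>2 + 2 * (cmod v)\<^sup>2"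
      using zero_le_power2[of "cmod u - cmod v"] by (simp add: power2_eq_square algebra_simps)
    finally show ?thesis .
  qed
  show ?thesis
    unfolding ell2_def mem_Collect_eq
    by (rule summable_comparison_test'[OF sm, where N = 0]) (simp add: le)
qed

lemma ell2_scale: "x \<in> ell2 \<Longrightarrow> (\<lambda>n. c * x n) \<in> ell2"
  by (simp add: ell2_def norm_mult power_mult_distrib summable_mult)

lemma ell2_cnj: "x \<in> ell2 \<Longrightarrow> (\<lambda>n. cnj (x n)) \<in> ell2"
  by (simp add: ell2_def)

lemma ell2_finite_support: "finite {n. x n \<noteq> 0} \<Longrightarrow> x \<in> ell2"
  unfolding ell2_def mem_Collect_eq by (rule summable_finite) auto

lemma basis_vec_ell2: "basis_vec m \<in> ell2"
  by (rule ell2_finite_support) (simp add: basis_vec_def)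

lemma summable_ell2_inner:
  assumes "x \<in> ell2" "y \<in> ell2"
  shows "summable (\<lambda>n. x n * cnj (y n))"
proof (rule summable_comparison_test'[where N = 0])
  show "summable (\<lambda>n. (cmod (x n))\<^sup>2 + (cmod (y n))\<^sup>2)"
    using assms by (intro summable_add) (auto simp: ell2_def)
  show "norm (x n * cnj (y n)) \<le> (cmod (x n))\<^sup>2 + (cmod (y n))\<^sup>2" for n
    using sum_squares_bound[of "cmod (x n)" "cmod (y n)"]
      mult_nonneg_nonneg[OF norm_ge_zero norm_ge_zero, of "x n" "y n"]
    unfolding norm_mult complex_mod_cnj by linarith
qed

lemma ell2_inner_add_left:
  "\<lbrakk>x \<in> ell2; y \<in> ell2; z \<in> ell2\<rbrakk> \<Longrightarrow>
    ell2_inner (\<lambda>n. x n + y n) z = ell2_inner x z + ell2_inner y z"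
  by (simp add: ell2_inner_def distrib_right suminf_add summable_ell2_inner)

lemma ell2_inner_scale_left:
  "\<lbrakk>x \<in> ell2; y \<in> ell2\<rbrakk> \<Longrightarrow> ell2_inner (\<lambda>n. c * x n) y = c * ell2_inner x y"
  by (simp add: ell2_inner_def mult.assoc suminf_mult summable_ell2_inner)

lemma ell2_inner_scale_right:
  "\<lbrakk>x \<in> ell2; y \<in> ell2\<rbrakk> \<Longrightarrow> ell2_inner x (\<lambda>n. c * y n) = cnj c * ell2_inner x y"
  by (simp add: ell2_inner_def mult.left_commute suminf_mult summable_ell2_inner)

lemma cnj_ell2_inner:
  assumes "x \<in> ell2" "y \<in> ell2"
  shows "cnj (ell2_inner x y) = (\<Sum>n. cnj (x n) * y n)"
  using bounded_linear.suminf[OF bounded_linear_cnj summable_ell2_inner[OF assms]]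
  by (simp add: ell2_inner_def)

lemma ell2_inner_self:
  "x \<in> ell2 \<Longrightarrow> ell2_inner x x = of_real (\<Sum>n. (cmod (x n))\<^sup>2)"
  by (simp add: ell2_inner_def ell2_def complex_norm_square[symmetric] suminf_of_real del: of_real_power)

lemma ell2_inner_basis_right: "ell2_inner x (basis_vec m) = x m"
proof -
  have "ell2_inner x (basis_vec m) = (\<Sum>n\<in>{m}. x n * cnj (basis_vec m n))"
    unfolding ell2_inner_def by (rule suminf_finite) (auto simp: basis_vec_def)
  then show ?thesis by (simp add: basis_vec_def)
qed

typedef ell2_vec = ell2
  using basis_vec_ell2 by blast

setup_lifting type_definition_ell2_vec

text \<open>The structure is real because an operator followed by conjugation is antilinear, hence
  linear only over the reals. Complex scalars act through \<open>cscale\<close>.\<close>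

instantiation ell2_vec :: real_inner
begin

lift_definition zero_ell2_vec :: ell2_vec is "\<lambda>_. 0"
  by (simp add: ell2_def)
lift_definition plus_ell2_vec :: "ell2_vec \<Rightarrow> ell2_vec \<Rightarrow> ell2_vec" is "\<lambda>x y n. x n + y n"
  by (rule ell2_add)
lift_definition uminus_ell2_vec :: "ell2_vec \<Rightarrow> ell2_vec" is "\<lambda>x n. - x n"
  by (simp add: ell2_def)
lift_definition minus_ell2_vec :: "ell2_vec \<Rightarrow> ell2_vec \<Rightarrow> ell2_vec" is "\<lambda>x y n. x n - y n"
  using ell2_add[OF _ ell2_scale[where c = "-1"]] by simp
lift_definition scaleR_ell2_vec :: "real \<Rightarrow> ell2_vec \<Rightarrow> ell2_vec" is "\<lambda>r x n. of_real r * x n"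
  by (rule ell2_scale)
lift_definition inner_ell2_vec :: "ell2_vec \<Rightarrow> ell2_vec \<Rightarrow> real" is "\<lambda>x y. Re (ell2_inner x y)" .

definition norm_ell2_vec :: "ell2_vec \<Rightarrow> real" where
  "norm_ell2_vec x = sqrt (inner x x)"
definition dist_ell2_vec :: "ell2_vec \<Rightarrow> ell2_vec \<Rightarrow> real" where
  "dist_ell2_vec x y = norm (x - y)"
definition sgn_ell2_vec :: "ell2_vec \<Rightarrow> ell2_vec" where
  "sgn_ell2_vec x = inverse (norm x) *\<^sub>R x"
definition uniformity_ell2_vec :: "(ell2_vec \<times> ell2_vec) filter" where
  "uniformity_ell2_vec = (INF e\<in>{0<..}. principal {(x, y). dist x y < e})"
definition open_ell2_vec :: "ell2_vec set \<Rightarrow> bool" where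
  "open_ell2_vec U = (\<forall>x\<in>U. eventually (\<lambda>(x', y). x' = x \<longrightarrow> y \<in> U) uniformity)"

instance
proof
  fix x y z :: ell2_vec and r s :: real
  show "x + y + z = x + (y + z)" by transfer (simp add: add.assoc)
  show "x + y = y + x" by transfer (simp add: add.commute)
  show "0 + x = x" by transfer simp
  show "- x + x = 0" by transfer simp
  show "x - y = x + - y" by transfer simp
  show "r *\<^sub>R (x + y) = r *\<^sub>R x + r *\<^sub>R y" by transfer (simp add: distrib_left)
  show "(r + s) *\<^sub>R x = r *\<^sub>R x + s *\<^sub>R x" by transfer (simp add: distrib_right)
  show "r *\<^sub>R s *\<^sub>R x = (r * s) *\<^sub>R x" by transfer (simp add: mult.assoc)
  show "1 *\<^sub>R x = x" by transfer simp
  show "inner x y = inner y x"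
  proof transfer
    fix x y :: "nat \<Rightarrow> complex" assume "x \<in> ell2" "y \<in> ell2"
    then have "cnj (ell2_inner x y) = ell2_inner y x"
      by (simp add: cnj_ell2_inner) (simp add: ell2_inner_def mult.commute)
    then show "Re (ell2_inner x y) = Re (ell2_inner y x)"
      by (metis cnj.sel(1))
  qed
  show "inner (x + y) z = inner x z + inner y z" by transfer (simp add: ell2_inner_add_left)
  show "inner (r *\<^sub>R x) y = r * inner x y" by transfer (simp add: ell2_inner_scale_left)
  show "0 \<le> inner x x"
    by transfer (simp add: ell2_inner_self suminf_nonneg ell2_def)
  show "inner x x = 0 \<longleftrightarrow> x = 0"
  proof transfer
    fix x :: "nat \<Rightarrow> complex" assume x: "x \<in> ell2"
    then have "(\<Sum>n. (cmod (x n))\<^sup>2) = 0 \<longleftrightarrow> (\<forall>n. (cmod (x n))\<^sup>2 = 0)"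
      by (intro suminf_eq_zero_iff) (auto simp: ell2_def)
    then show "Re (ell2_inner x x) = 0 \<longleftrightarrow> x = (\<lambda>_. 0)"
      using x by (auto simp: ell2_inner_self)
  qed
  show "norm x = sqrt (inner x x)" by (rule norm_ell2_vec_def)
  show "dist x y = norm (x - y)" by (rule dist_ell2_vec_def)
  show "sgn x = inverse (norm x) *\<^sub>R x" by (rule sgn_ell2_vec_def)
  show "uniformity = (INF e\<in>{0<..}. principal {(x :: ell2_vec, y). dist x y < e})"
    by (rule uniformity_ell2_vec_def)
  show "open U \<longleftrightarrow> (\<forall>x\<in>U. eventually (\<lambda>(x', y). x' = x \<longrightarrow> y \<in> U) uniformity)"
    for U :: "ell2_vec set"
    by (rule open_ell2_vec_def)
qed

end

lift_definition cscale :: "complex \<Rightarrow> ell2_vec \<Rightarrow> ell2_vec" is "\<lambda>c x n. c * x n"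
  by (rule ell2_scale)

lift_definition ell2_basis :: "nat \<Rightarrow> ell2_vec" is basis_vec
  by (rule basis_vec_ell2)

lemma norm_ell2_vec_sq: "(norm x)\<^sup>2 = (\<Sum>n. (cmod (Rep_ell2_vec x n))\<^sup>2)"
  unfolding power2_norm_eq_inner[of x] inner_ell2_vec.rep_eq
  by (simp add: ell2_inner_self Rep_ell2_vec)

lemma norm_ell2_vec_eq: "norm x = ell2_norm (Rep_ell2_vec x)"
  unfolding ell2_norm_def norm_ell2_vec_sq[symmetric] by simp

lemma Rep_sum_ell2_vec: "Rep_ell2_vec (sum f A) n = (\<Sum>i\<in>A. Rep_ell2_vec (f i) n)"
  by (induction A rule: infinite_finite_induct) (auto simp: zero_ell2_vec.rep_eq plus_ell2_vec.rep_eq)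

text \<open>The squared distance is the tail of a convergent series. This carries identities from
  basis vectors to all vectors.\<close>

lemma ell2_truncation_tendsto:
  "(\<lambda>k. \<Sum>i<k. cscale (Rep_ell2_vec x i) (ell2_basis i)) \<longlonglongrightarrow> x"
proof -
  let ?t = "\<lambda>k. \<Sum>i<k. cscale (Rep_ell2_vec x i) (ell2_basis i)"
  let ?f = "\<lambda>n. (cmod (Rep_ell2_vec x n))\<^sup>2"
  have sm: "summable ?f"
    using Rep_ell2_vec[of x] by (simp add: ell2_def)
  have t: "Rep_ell2_vec (?t k) n = (if n < k then Rep_ell2_vec x n else 0)" for k n
  proof -
    have "Rep_ell2_vec (?t k) n = (\<Sum>i<k. if i = n then Rep_ell2_vec x n else 0)"
      unfolding Rep_sum_ell2_vec cscale.rep_eq ell2_basis.rep_eq basis_vec_def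
      by (intro sum.cong) auto
    then show ?thesis by simp
  qed
  have "(norm (?t k - x))\<^sup>2 = suminf ?f - sum ?f {..<k}" for k
  proof -
    have "(norm (?t k - x))\<^sup>2 = (\<Sum>n. ?f n - (if n < k then ?f n else 0))"
      unfolding norm_ell2_vec_sq
      by (intro suminf_cong) (simp add: minus_ell2_vec.rep_eq t norm_minus_cancel)
    also have "\<dots> = suminf ?f - (\<Sum>n. if n < k then ?f n else 0)"
      by (rule suminf_diff[symmetric]) (auto intro: sm summable_finite[of "{..<k}"])
    also have "(\<Sum>n. if n < k then ?f n else 0) = (\<Sum>n<k. if n < k then ?f n else 0)"
      by (rule suminf_finite) auto
    finally show ?thesis by simp
  qed
  moreover have "(\<lambda>k. suminf ?f - sum ?f {..<k}) \<longlonglongrightarrow> suminf ?f - suminf ?f"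
    by (intro tendsto_diff tendsto_const summable_LIMSEQ sm)
  ultimately have "(\<lambda>k. (norm (?t k - x))\<^sup>2) \<longlonglongrightarrow> 0"
    by simp
  then have "(\<lambda>k. norm (?t k - x)) \<longlonglongrightarrow> 0"
    using tendsto_real_sqrt by fastforce
  then show ?thesis
    using LIM_zero_iff tendsto_norm_zero_iff by blast
qed

section \<open>Operators transported to \<open>ell2_vec\<close>\<close>

definition lift_op :: "((nat \<Rightarrow> complex) \<Rightarrow> nat \<Rightarrow> complex) \<Rightarrow> ell2_vec \<Rightarrow> ell2_vec" where
  "lift_op T x = Abs_ell2_vec (T (Rep_ell2_vec x))"

definition lift_conj_op :: "((nat \<Rightarrow> complex) \<Rightarrow> nat \<Rightarrow> complex) \<Rightarrow> ell2_vec \<Rightarrow> ell2_vec" where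
  "lift_conj_op T x = Abs_ell2_vec (\<lambda>n. cnj (T (Rep_ell2_vec x) n))"

context
  fixes T
  assumes T: "bounded_op T"
begin

lemma bounded_op_ell2: "x \<in> ell2 \<Longrightarrow> T x \<in> ell2"
  using T by (simp add: bounded_op_def)

lemma bounded_op_add: "x \<in> ell2 \<Longrightarrow> y \<in> ell2 \<Longrightarrow> T (\<lambda>n. x n + y n) = (\<lambda>n. T x n + T y n)"
  using T by (simp add: bounded_op_def)

lemma bounded_op_scale: "x \<in> ell2 \<Longrightarrow> T (\<lambda>n. c * x n) = (\<lambda>n. c * T x n)"
  using T by (simp add: bounded_op_def)

lemma Rep_lift_op: "Rep_ell2_vec (lift_op T x) = T (Rep_ell2_vec x)"
  by (simp add: lift_op_def Abs_ell2_vec_inverse Rep_ell2_vec bounded_op_ell2)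

lemma Rep_lift_conj_op: "Rep_ell2_vec (lift_conj_op T x) = (\<lambda>n. cnj (T (Rep_ell2_vec x) n))"
  by (simp add: lift_conj_op_def Abs_ell2_vec_inverse Rep_ell2_vec bounded_op_ell2 ell2_cnj)

lemma linear_lift_op: "linear (lift_op T)"
  by (rule linearI; simp add: Rep_ell2_vec_inject[symmetric] Rep_lift_op plus_ell2_vec.rep_eq
      scaleR_ell2_vec.rep_eq bounded_op_add bounded_op_scale Rep_ell2_vec)

lemma linear_lift_conj_op: "linear (lift_conj_op T)"
  by (rule linearI; simp add: Rep_ell2_vec_inject[symmetric] Rep_lift_conj_op plus_ell2_vec.rep_eq
      scaleR_ell2_vec.rep_eq bounded_op_add bounded_op_scale Rep_ell2_vec)

lemma lift_op_cscale: "lift_op T (cscale c x) = cscale c (lift_op T x)"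
  by (simp add: Rep_ell2_vec_inject[symmetric] Rep_lift_op cscale.rep_eq bounded_op_scale Rep_ell2_vec)

lemma lift_conj_op_cscale: "lift_conj_op T (cscale c x) = cscale (cnj c) (lift_conj_op T x)"
  by (simp add: Rep_ell2_vec_inject[symmetric] Rep_lift_conj_op cscale.rep_eq bounded_op_scale Rep_ell2_vec)

lemma norm_lift_conj_op: "norm (lift_conj_op T x) = norm (lift_op T x)"
  by (simp add: norm_ell2_vec_eq Rep_lift_op Rep_lift_conj_op ell2_norm_def)

lemma lift_op_bounded: "\<exists>t>0. \<forall>x. norm (lift_op T x) \<le> t * norm x"
proof -
  obtain C where C: "\<And>x. x \<in> ell2 \<Longrightarrow> ell2_norm (T x) \<le> C * ell2_norm x"
    using T unfolding bounded_op_def by blast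
  have "norm (lift_op T x) \<le> max C 1 * norm x" for x
    unfolding norm_ell2_vec_eq Rep_lift_op
    by (rule order_trans[OF C[OF Rep_ell2_vec]], rule mult_right_mono)
      (auto simp: norm_ell2_vec_eq[symmetric])
  then show ?thesis
    by (intro exI[of _ "max C 1"]) auto
qed

lemma bounded_linear_lift_conj_op: "bounded_linear (lift_conj_op T)"
proof -
  obtain t where t: "\<And>x. norm (lift_op T x) \<le> t * norm x"
    using lift_op_bounded by blast
  show ?thesis
    using linear_lift_conj_op t
    by (auto simp: bounded_linear_def bounded_linear_axioms_def norm_lift_conj_op mult.commute
        intro!: exI[of _ t])
qed

end

lemma inner_cscale_cscale:
  "inner (cscale c x) (cscale d y) = Re (c * cnj d * ell2_inner (Rep_ell2_vec x) (Rep_ell2_vec y))"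
  by (simp add: inner_ell2_vec.rep_eq cscale.rep_eq ell2_inner_scale_left ell2_inner_scale_right
      Rep_ell2_vec ell2_scale mult_ac)

lemma cscale_add: "cscale c (x + y) = cscale c x + cscale c y"
  by transfer (simp add: distrib_left)

lemma cscale_cscale: "cscale c (cscale d x) = cscale (c * d) x"
  by transfer (simp add: mult.assoc)

lemma cscale_1: "cscale 1 x = x"
  by transfer simp

lemma cscale_minus_1: "cscale (- 1) x = - x"
  by transfer simp

text \<open>Over the complex numbers a form with real diagonal is Hermitian.\<close>

lemma positive_op_symmetric:
  assumes "positive_op P"
  shows "inner (lift_op P x) y = inner x (lift_op P y)"
proof -
  have P: "bounded_op P"
    using assms by (simp add: positive_op_def)
  let ?N = "lift_op P" and ?I = "cscale \<i>"
  \<comment> \<open>The real inner product with i x picks out the imaginary part of <P x,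
    x>.\<close>
  have zero: "inner (?N x) (?I x) = 0" for x
    using assms inner_cscale_cscale[of 1 "?N x" \<i> x]
    by (simp add: cscale_1 positive_op_def Rep_lift_op[OF P] Rep_ell2_vec)
  have iso: "inner (?I x) (?I y) = inner x y" for x y
    using inner_cscale_cscale[of 1 x 1 y] inner_cscale_cscale[of \<i> x \<i> y]
    by (simp add: cscale_1)
  have II: "?I (?I x) = - x" for x
    by (simp add: cscale_cscale cscale_minus_1)
  have zero': "inner (?I (?N y)) y = 0" for y
    using iso[of "?I (?N y)" y] zero[of y] by (simp add: II)
  \<comment> \<open>Polarisation of \<open>zero\<close> at x + i y: only the mixed terms
    survive.\<close>
  have "0 = inner (?N (x + ?I y)) (?I (x + ?I y))"
    by (simp only: zero)
  also have "\<dots> = inner (?N x + ?I (?N y)) (?I x - y)"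
    by (simp add: linear_add[OF linear_lift_op[OF P]] lift_op_cscale[OF P] cscale_add II)
  also have "\<dots> = inner (?N y) x - inner (?N x) y"
    by (simp add: inner_simps zero zero' iso)
  finally show ?thesis
    by (simp add: inner_commute)
qed

text \<open>Conjugation makes the form bilinear in c and d, so for c = d a phase acts through d^2
  and can rotate a diagonal entry onto the positive axis.\<close>

lemma inner_lift_conj_op_basis:
  assumes T: "bounded_op T"
  shows "inner (lift_conj_op T (cscale c (ell2_basis m))) (cscale d (ell2_basis n))
    = Re (c * d * T (basis_vec m) n)"
proof -
  have "inner (lift_conj_op T (cscale c (ell2_basis m))) (cscale d (ell2_basis n))
      = Re (cnj (c * d * T (basis_vec m) n))"
    unfolding lift_conj_op_cscale[OF T] inner_cscale_cscale
    by (simp add: ell2_basis.rep_eq ell2_inner_basis_right Rep_lift_conj_op[OF T])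
  then show ?thesis by (simp only: cnj.sel)
qed

lemma lift_conj_op_symmetric:
  assumes T: "bounded_op T" and sym: "\<And>m n. T (basis_vec m) n = T (basis_vec n) m"
  shows "inner (lift_conj_op T x) y = inner x (lift_conj_op T y)"
proof -
  let ?M = "lift_conj_op T"
  let ?t = "\<lambda>x k. \<Sum>i<k. cscale (Rep_ell2_vec x i) (ell2_basis i)"
  note lin = linear_sum[OF linear_lift_conj_op[OF T]]
  have eq: "inner (?M (?t x k)) (?t y k) = inner (?M (?t y k)) (?t x k)" for k
    unfolding lin inner_sum_left inner_sum_right inner_lift_conj_op_basis[OF T]
    by (subst sum.swap, intro sum.cong refl) (simp add: sym[of _ "_ :: nat"] mult_ac)
  have lim: "(\<lambda>k. inner (?M (?t x k)) (?t y k)) \<longlonglongrightarrow> inner (?M x) y" for x y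
    by (intro tendsto_inner bounded_linear.tendsto[OF bounded_linear_lift_conj_op[OF T]]
        ell2_truncation_tendsto)
  have "inner (?M x) y = inner (?M y) x"
    using lim[of x y] lim[of y x] unfolding eq by (rule LIMSEQ_unique)
  then show ?thesis
    by (simp only: inner_commute)
qed

section \<open>Trace class L-operators\<close>

text \<open>J e_n has finite support, so e_n lies in the domain of J and e_n = L (J e_n). This
  supplies the range condition of \<open>le_positive_sqrt_on_range\<close>.\<close>

lemma basis_vec_in_range_L_op:
  assumes "regular a"
  shows "\<exists>f\<in>ell2. snd (L_op a) f = basis_vec n"
proof -
  let ?f = "mat_apply (jacobi a) (basis_vec n)"
  have "?f m = 0" if "m \<notin> {..Suc n}" for m
    using that by (cases m) (auto simp: mat_apply_jacobi_0 mat_apply_jacobi_Suc basis_vec_def)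
  then have "{m. ?f m \<noteq> 0} \<subseteq> {..Suc n}"
    by blast
  then have f: "?f \<in> ell2"
    using finite_subset by (intro ell2_finite_support) blast
  then have dom: "basis_vec n \<in> fst (J_op a)"
    by (simp add: J_op_def basis_vec_ell2)
  have "snd (L_op a) (snd (J_op a) (basis_vec n)) = basis_vec n"
    unfolding L_op_def op_inverse_def snd_conv
    by (rule the_inv_into_f_f[OF inj_on_J_op[OF assms] dom])
  then show ?thesis
    using f by (auto simp: J_op_def)
qed

text \<open>A complex symmetric operator \<open>T\<close> composed with complex conjugation is a symmetric real
  operator \<open>M\<close> with \<open>M\<^sup>2 = T\<^sup>* T = P\<^sup>2\<close>.\<close>

lemma abs_op_diag_bounds:
  assumes T: "bounded_op T" and sym: "\<And>m n. T (basis_vec m) n = T (basis_vec n) m"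
    and P: "is_abs_op T P"
    and range: "f \<in> ell2" "T f = basis_vec n"
  shows "cmod (T (basis_vec n) n) \<le> Re (ell2_inner (P (basis_vec n)) (basis_vec n))"
    and "\<And>t. 0 < t \<Longrightarrow> \<forall>x. norm (lift_op P x) \<le> t * norm x \<Longrightarrow>
      (norm (lift_op T (ell2_basis n)))\<^sup>2 \<le> t * Re (ell2_inner (P (basis_vec n)) (basis_vec n))"
proof -
  let ?M = "lift_conj_op T" and ?N = "lift_op P"
  have pos: "positive_op P" and bP: "bounded_op P"
    using P by (auto simp: is_abs_op_def positive_op_def)
  note linM = linear_lift_conj_op[OF T] and linN = linear_lift_op[OF bP]
    and symM = lift_conj_op_symmetric[OF T sym] and symN = positive_op_symmetric[OF pos]
  have posN: "inner (?N x) x \<ge> 0" for x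
    using pos by (simp add: positive_op_def inner_ell2_vec.rep_eq Rep_lift_op[OF bP] Rep_ell2_vec)
  have sq: "?M (?M x) = ?N (?N x)" for x
  proof -
    \<comment> \<open>\<open>is_abs_op\<close> expresses the square of P only weakly, so both
      squares are tested against every y; real parts ignore the conjugation.\<close>
    have "inner (?M (?M x)) y = inner (?N (?N x)) y" for y
    proof -
      have "inner (?M (?M x)) y = inner (?M x) (?M y)"
        by (rule symM)
      also have "\<dots> = Re (cnj (ell2_inner (T (Rep_ell2_vec x)) (T (Rep_ell2_vec y))))"
        unfolding inner_ell2_vec.rep_eq Rep_lift_conj_op[OF T]
        by (subst cnj_ell2_inner)
          (auto simp: bounded_op_ell2[OF T] Rep_ell2_vec ell2_inner_def)
      also have "\<dots> = inner (?N (?N x)) y"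
        using P by (simp add: is_abs_op_def inner_ell2_vec.rep_eq Rep_lift_op[OF bP] Rep_ell2_vec)
      finally show ?thesis .
    qed
    then have "inner (?M (?M x) - ?N (?N x)) (?M (?M x) - ?N (?N x)) = 0"
      by (simp only: inner_diff_left)
    then show ?thesis
      by simp
  qed
  have diag: "inner (?N (ell2_basis n)) (ell2_basis n) = Re (ell2_inner (P (basis_vec n)) (basis_vec n))"
    by (simp add: inner_ell2_vec.rep_eq Rep_lift_op[OF bP] ell2_basis.rep_eq)
  obtain t where t: "t > 0" "\<And>x. norm (?N x) \<le> t * norm x"
    using lift_op_bounded[OF bP] by blast
  define \<alpha> where "\<alpha> = T (basis_vec n) n"
  \<comment> \<open>a phase with \<open>d\<^sup>2 \<alpha> = \<bar>\<alpha>\<bar>\<close>\<close>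
  define d where "d = csqrt (cnj (sgn \<alpha>))"
  show "cmod (T (basis_vec n) n) \<le> Re (ell2_inner (P (basis_vec n)) (basis_vec n))"
  proof (cases "\<alpha> = 0")
    case True
    then show ?thesis
      using posN[of "ell2_basis n"] by (simp add: \<alpha>_def diag)
  next
    case False
    have "d * d = cnj (sgn \<alpha>)"
      by (simp add: d_def power2_eq_square[symmetric])
    moreover have "cnj (sgn \<alpha>) * \<alpha> = of_real (cmod \<alpha>)"
      using False complex_norm_square[of \<alpha>]
      by (simp add: sgn_eq field_simps power2_eq_square)
    ultimately have d\<alpha>: "d * d * \<alpha> = of_real (cmod \<alpha>)"
      by simp
    have "(cmod d)\<^sup>2 = cmod (d * d)"
      by (simp add: norm_mult power2_eq_square)
    also have "\<dots> = 1"
      using False \<open>d * d = _\<close> by (simp add: norm_sgn)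
    finally have dd: "d * cnj d = 1"
      by (simp add: complex_norm_square[symmetric] del: of_real_power)
    let ?x = "cscale d (ell2_basis n)"
    \<comment> \<open>\<open>?M\<close> is antilinear and e_n is real, so the conjugate phase on f
      produces d e_n.\<close>
    have "?M (cscale (cnj d) (Abs_ell2_vec f)) = ?x"
      using range unfolding lift_conj_op_cscale[OF T]
      by (simp add: Rep_ell2_vec_inject[symmetric] cscale.rep_eq Rep_lift_conj_op[OF T]
          Abs_ell2_vec_inverse ell2_basis.rep_eq) (simp add: basis_vec_def fun_eq_iff)
    then have "?x \<in> range ?M"
      by (metis rangeI)
    from le_positive_sqrt_on_range[OF linM linN symM symN posN t(2,1) sq this]
    have "inner (?M ?x) ?x \<le> inner (?N ?x) ?x" .
    moreover have "inner (?M ?x) ?x = cmod \<alpha>"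
      unfolding inner_lift_conj_op_basis[OF T] \<alpha>_def[symmetric] d\<alpha> by simp
    \<comment> \<open>\<open>?N\<close> is complex linear and |d| = 1, so here the phase drops
      out.\<close>
    moreover have "inner (?N ?x) ?x = inner (?N (ell2_basis n)) (ell2_basis n)"
      unfolding lift_op_cscale[OF bP] inner_cscale_cscale dd by (simp add: inner_ell2_vec.rep_eq)
    ultimately show ?thesis
      by (simp add: diag \<alpha>_def)
  qed
  fix t :: real
  assume "0 < t" and bnd: "\<forall>x. norm (?N x) \<le> t * norm x"
  have "norm (lift_op T (ell2_basis n)) = norm (?N (ell2_basis n))"
    by (subst norm_lift_conj_op[OF T, symmetric]) (simp only: norm_eq_sqrt_inner symM symN sq)
  then show "(norm (lift_op T (ell2_basis n)))\<^sup>2 \<le> t * Re (ell2_inner (P (basis_vec n)) (basis_vec n))"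
    using positive_sq_norm_le[OF linN symN posN, of t "ell2_basis n"] bnd by (simp add: diag)
qed

lemma trace_class_L_summable:
  assumes "regular a" and tc: "trace_class (L_op a)" and L: "has_L_matrix (L_op a) a"
  shows "summable (\<lambda>n. cmod (a n))" and "summable (\<lambda>n. real n * (cmod (a n))\<^sup>2)"
proof -
  let ?T = "snd (L_op a)"
  obtain P where T: "bounded_op ?T" and P: "is_abs_op ?T P"
    and sm: "summable (\<lambda>n. Re (ell2_inner (P (basis_vec n)) (basis_vec n)))"
    using tc by (auto simp: trace_class_def)
  let ?p = "\<lambda>n. Re (ell2_inner (P (basis_vec n)) (basis_vec n))"
  have bP: "bounded_op P"
    using P by (auto simp: is_abs_op_def positive_op_def)
  have entry: "?T (basis_vec n) m = a (max m n)" for m n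
    using L by (simp add: has_L_matrix_def matrix_entry_def ell2_inner_basis_right L_matrix_def)
  have sym: "?T (basis_vec m) n = ?T (basis_vec n) m" for m n
    by (simp add: entry max.commute)
  have diag: "cmod (a n) \<le> ?p n" for n
    using basis_vec_in_range_L_op[OF assms(1), of n] abs_op_diag_bounds(1)[OF T sym P, of _ n]
    by (auto simp: entry)
  show "summable (\<lambda>n. cmod (a n))"
    by (rule summable_comparison_test'[OF sm, where N = 0]) (simp add: diag)
  obtain t where t: "t > 0" "\<forall>x. norm (lift_op P x) \<le> t * norm x"
    using lift_op_bounded[OF bP] by blast
  have "real n * (cmod (a n))\<^sup>2 \<le> t * ?p n" for n
  proof -
    let ?c = "Rep_ell2_vec (lift_op ?T (ell2_basis n))"
    have c: "?c m = a (max m n)" for m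
      by (simp add: Rep_lift_op[OF T] ell2_basis.rep_eq entry)
    \<comment> \<open>The n entries of column n above the diagonal all equal a n.\<close>
    have "real n * (cmod (a n))\<^sup>2 = (\<Sum>m<n. (cmod (?c m))\<^sup>2)"
      by (simp add: c max.absorb2)
    also have "\<dots> \<le> (\<Sum>m. (cmod (?c m))\<^sup>2)"
      using Rep_ell2_vec[of "lift_op ?T (ell2_basis n)"] by (intro sum_le_suminf) (auto simp: ell2_def)
    also have "\<dots> = (norm (lift_op ?T (ell2_basis n)))\<^sup>2"
      by (rule norm_ell2_vec_sq[symmetric])
    also have "\<dots> \<le> t * ?p n"
      using basis_vec_in_range_L_op[OF assms(1), of n] abs_op_diag_bounds(2)[OF T sym P _ _ t] by blast
    finally show ?thesis .
  qed
  then show "summable (\<lambda>n. real n * (cmod (a n))\<^sup>2)"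
    by (intro summable_comparison_test'[OF summable_mult[OF sm, of t], where N = 0]) auto
qed

section \<open>Passage to the limit\<close>

lemma norm_chain_prod:
  fixes u :: "nat \<Rightarrow> nat \<Rightarrow> 'a::{real_normed_div_algebra, comm_ring_1}"
  shows "norm (chain_prod u xs) = chain_prod (\<lambda>l m. norm (u l m)) xs"
  by (simp add: chain_prod_def prod_norm)

theorem theorem13:
  fixes a :: "nat \<Rightarrow> complex"
  assumes "regular a"
    and "trace_class (L_op a)"
    and "has_L_matrix (L_op a) a"
  shows "\<forall>z. (\<lambda>n. (-1) ^ n * (\<Prod>j=1..n-1. a (j - 1) - a j) *
             (a (n - 1) * p_poly a n z + a n * b_seq a (n - 1) * p_poly a (n - 1) z))
           \<longlonglongrightarrow> fredholm_det_one_plus (op_scale (- z) (L_op a))"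
proof
  fix z
  let ?F = "\<lambda>n. (-1) ^ n * (\<Prod>j=1..n-1. a (j - 1) - a j) *
             (a (n - 1) * p_poly a n z + a n * b_seq a (n - 1) * p_poly a (n - 1) z)"
  let ?M = "matrix_entry (op_scale (- z) (L_op a))"
  let ?u = "\<lambda>l m. a l - a m"
  define w where "w = principal_minor ?M"
  have M: "?M i j = - z * a (max i j)" for i j
    using assms(3)
    by (simp add: matrix_entry_def op_scale_def ell2_inner_basis_right has_L_matrix_def L_matrix_def)
  have w0: "w {} = 1"
    by (simp add: w_def principal_minor_empty)
  have w1: "w (insert m S) =
      a m * ((- z) ^ Suc (card S) * chain_prod ?u (sorted_list_of_set S @ [m]))"
    if "S \<subseteq> {..<m}" for m S
    unfolding w_def using that M by (rule principal_minor_max_matrix[where a = a])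
  \<comment> \<open>The truncated n - 1 spoils this identity at index 0, so terms are matched from
    index 1 on; \<open>LIMSEQ_imp_Suc\<close> undoes the shift.\<close>
  have "(\<Sum>S\<in>Pow {..<Suc n}. w S) = ?F (Suc n)" for n
    unfolding diff_Suc_1 finite_section_formula[OF assms(1)]
    by (subst sum_Pow_chain[OF w0 w1]) (simp_all add: mult.commute)
  moreover have "(\<lambda>n. \<Sum>S\<in>Pow {..<n}. w S) \<longlonglongrightarrow> (\<Sum>k. infsum w {S. finite S \<and> card S = k})"
  proof -
    \<comment> \<open>Norms of minors have the chain form again, now with |z| and |a l - a m|, which
      the triangle inequality fits to \<open>chain_sum_bound\<close>.\<close>
    have "(\<Sum>S\<in>Pow {..<n}. norm (w S))
        = 1 + (\<Sum>m<n. chain_sum (\<lambda>l m. cmod (?u l m)) (cmod z) m * cmod (a m))" for n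
      by (rule sum_Pow_chain)
        (simp_all only: w0 w1 norm_mult norm_power norm_chain_prod norm_minus_cancel norm_one)
    moreover obtain B where "\<And>n. 1 + (\<Sum>m<n. chain_sum (\<lambda>l m. cmod (?u l m)) (cmod z) m * cmod (a m)) \<le> B"
      using chain_sum_bound[of "cmod z" "\<lambda>n. cmod (a n)" "\<lambda>l m. cmod (?u l m)"]
        trace_class_L_summable[OF assms] norm_triangle_ineq4 by auto
    ultimately show ?thesis
      by (intro sum_Pow_tendsto_sum_by_card[where B = B]) simp
  qed
  ultimately have "(\<lambda>n. ?F (Suc n)) \<longlonglongrightarrow> (\<Sum>k. infsum w {S. finite S \<and> card S = k})"
    using LIMSEQ_Suc by fastforce
  then show "?F \<longlonglongrightarrow> fredholm_det_one_plus (op_scale (- z) (L_op a))"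
    unfolding fredholm_det_one_plus_def trace_ext_power_def w_def by (rule LIMSEQ_imp_Suc)
qed

end
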